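(* (i) If $\sigma$ is an automorphism of $\mathbb{Z}^2$ which, viewed as an element of $\operatorname{GL}_2(\mathbb{Z})$, has exactly two nonzero entries, then there exists a subset $A$ of $\mathbb{Z}^2$ such that $(A, \sigma(A))$ is a co-minimal pair in $\mathbb{Z}^2$. (ii) For every integer $d \geq 1$, the group $\mathbb{Z}^{2d}$ admits infinitely many automorphisms such that for each such automorphism $\sigma$, there exists a subset $A$ of $\mathbb{Z}^{2d}$ such that $(A, \sigma(A))$ is a co-minimal pair in $\mathbb{Z}^{2d}$.
   Context: For nonempty subsets $A, B$ of an abelian group $(G,+)$, write $A + B = \{a+b \mid a\in A, b\in B\}$. The pair $(A,B)$ is called a co-minimal pair in $G$ if $A + B = G$, $A' + B \subsetneq G$ for every $\emptyset \neq A' \subsetneq A$, and $A + B' \subsetneq G$ for every $\emptyset \neq B' \subsetneq B$. Automorphisms are group automorphisms. *)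

theory Defs
  imports "HOL-Algebra.Bij" "HOL-Algebra.Coset" "Jordan_Normal_Form.Matrix"
begin

definition co_minimal_pair :: "('a, 'b) monoid_scheme \<Rightarrow> 'a set \<Rightarrow> 'a set \<Rightarrow> bool" where
  "co_minimal_pair G A B \<longleftrightarrow>
     A \<subseteq> carrier G \<and> A \<noteq> {} \<and> B \<subseteq> carrier G \<and> B \<noteq> {} \<and>
     A <#>\<^bsub>G\<^esub> B = carrier G \<and>
     (\<forall>A'. A' \<noteq> {} \<and> A' \<subset> A \<longrightarrow> A' <#>\<^bsub>G\<^esub> B \<subset> carrier G) \<and>
     (\<forall>B'. B' \<noteq> {} \<and> B' \<subset> B \<longrightarrow> A <#>\<^bsub>G\<^esub> B' \<subset> carrier G)"

text \<open>The additive group $\mathbb{Z}^n$ in the multiplicative record notation of HOL-Algebra: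
  its \<open>\<otimes>\<close> is the componentwise addition of integer vectors.\<close>

abbreviation int_lattice :: "nat \<Rightarrow> int vec monoid" where
  "int_lattice n \<equiv> monoid_vec TYPE(int) n"

text \<open>The elements of \<open>auto G\<close> are extensional (\<open>undefined\<close> outside the carrier), so distinct
  elements are distinct as maps on the carrier, and a set of automorphisms that is infinite as
  a set of HOL functions really consists of infinitely many automorphisms.\<close>

definition matrix_of :: "nat \<Rightarrow> (int vec \<Rightarrow> int vec) \<Rightarrow> int mat" where
  "matrix_of n \<sigma> = mat n n (\<lambda>(i, j). \<sigma> (unit_vec n j) $ i)"

definition nonzero_entries :: "'a::zero mat \<Rightarrow> (nat \<times> nat) set" where
  "nonzero_entries M = {(i, j). i < dim_row M \<and> j < dim_col M \<and> M $$ (i, j) \<noteq> 0}"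

lemma matrix_of_mult_vec:
  assumes \<sigma>: "\<sigma> \<in> hom (int_lattice n) (int_lattice n)" and v: "v \<in> carrier_vec n"
  shows "matrix_of n \<sigma> *\<^sub>v v = \<sigma> v"
proof -
  have clo: "\<sigma> x \<in> carrier_vec n" if "x \<in> carrier_vec n" for x
    using \<sigma> that by (auto simp: hom_def monoid_vec_simps)
  have add: "\<sigma> (x + y) = \<sigma> x + \<sigma> y" if "x \<in> carrier_vec n" "y \<in> carrier_vec n" for x y
    using \<sigma> that by (auto simp: hom_def monoid_vec_simps)
  have zero: "\<sigma> (0\<^sub>v n) = 0\<^sub>v n"
  proof (rule eq_vecI)
    fix i assume "i < dim_vec (0\<^sub>v n :: int vec)"
    then have i: "i < n" by simp
    have "\<sigma> (0\<^sub>v n) = \<sigma> (0\<^sub>v n) + \<sigma> (0\<^sub>v n)"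
      using add[of "0\<^sub>v n" "0\<^sub>v n"] by simp
    then have "\<sigma> (0\<^sub>v n) $ i = \<sigma> (0\<^sub>v n) $ i + \<sigma> (0\<^sub>v n) $ i"
      using i clo[of "0\<^sub>v n"] by (metis carrier_vecD index_add_vec(1) zero_carrier_vec)
    then show "\<sigma> (0\<^sub>v n) $ i = 0\<^sub>v n $ i" using i by simp
  qed (use clo[of "0\<^sub>v n"] in auto)
  have scale: "\<sigma> (k \<cdot>\<^sub>v x) = k \<cdot>\<^sub>v \<sigma> x" if x: "x \<in> carrier_vec n" for k x
  proof (induction k rule: int_induct[where k = 0])
    case base
    have "0 \<cdot>\<^sub>v x = 0\<^sub>v n" "0 \<cdot>\<^sub>v \<sigma> x = 0\<^sub>v n" using x clo[OF x] by auto
    then show ?case using zero by simp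
  next
    case (step1 i)
    then show ?case using x clo[OF x] add[of "i \<cdot>\<^sub>v x" x] by (simp add: add_smult_distrib_vec)
  next
    case (step2 i)
    have eq: "i \<cdot>\<^sub>v x = (i - 1) \<cdot>\<^sub>v x + x"
      using x by (intro eq_vecI) (auto simp: algebra_simps)
    have sum: "i \<cdot>\<^sub>v \<sigma> x = \<sigma> ((i - 1) \<cdot>\<^sub>v x) + \<sigma> x"
      using add[of "(i - 1) \<cdot>\<^sub>v x" x] step2 eq x by simp
    have dims: "dim_vec (\<sigma> x) = n" "dim_vec (\<sigma> ((i - 1) \<cdot>\<^sub>v x)) = n"
      using clo[OF x] clo[of "(i - 1) \<cdot>\<^sub>v x"] x by auto
    show ?case
    proof (rule eq_vecI)
      fix l assume "l < dim_vec ((i - 1) \<cdot>\<^sub>v \<sigma> x)"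
      then have "l < n" using dims by simp
      then show "\<sigma> ((i - 1) \<cdot>\<^sub>v x) $ l = ((i - 1) \<cdot>\<^sub>v \<sigma> x) $ l"
        using arg_cong[OF sum, of "\<lambda>w. w $ l"] dims by (simp add: algebra_simps)
    qed (use dims in simp)
  qed
  let ?M = "matrix_of n \<sigma>"
  have M: "?M \<in> carrier_mat n n" by (simp add: matrix_of_def)
  have unit: "?M *\<^sub>v unit_vec n j = \<sigma> (unit_vec n j)" if "j < n" for j
    using that clo[of "unit_vec n j"] M
    by (intro eq_vecI) (auto simp: matrix_of_def)
  have M_scale: "?M *\<^sub>v (k \<cdot>\<^sub>v x) = k \<cdot>\<^sub>v (?M *\<^sub>v x)" if "x \<in> carrier_vec n" for k x
    using that M by (intro eq_vecI) auto
  have "?M *\<^sub>v w = \<sigma> w" if "w \<in> carrier_vec n" "m \<le> n" "\<forall>j<n. m \<le> j \<longrightarrow> w $ j = 0" for m w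
    using that
  proof (induction m arbitrary: w)
    case 0
    then have "w = 0\<^sub>v n" by (intro eq_vecI) auto
    then show ?case using zero M by auto
  next
    case (Suc m)
    define u where "u = vec n (\<lambda>j. if j = m then 0 else w $ j)"
    have u: "u \<in> carrier_vec n" by (simp add: u_def)
    have w: "w = u + w $ m \<cdot>\<^sub>v unit_vec n m"
      using Suc.prems by (intro eq_vecI) (auto simp: u_def)
    have "?M *\<^sub>v u = \<sigma> u"
      using Suc.prems by (intro Suc.IH) (auto simp: u_def)
    then have "?M *\<^sub>v (u + w $ m \<cdot>\<^sub>v unit_vec n m) = \<sigma> (u + w $ m \<cdot>\<^sub>v unit_vec n m)"
      using Suc.prems u M
      by (simp add: mult_add_distrib_mat_vec[OF M] M_scale unit add scale)
    then show ?case using w by simp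
  qed
  from this[of v n] v show ?thesis by simp
qed

end

theory Submission
  imports Defs
begin

text \<open>
  An element \<open>a\<close> of \<open>A\<close> cannot be dropped as soon as some \<open>g\<close> has all its representations
  \<open>g = a' + b\<close> with \<open>a' = a\<close>; such a \<open>g\<close> is a witness for \<open>a\<close>. Every co-minimal pair below
  is obtained by covering the group and exhibiting a witness for each element of \<open>A\<close> and each
  element of \<open>B\<close> (\<open>co_minimal_pair_by_witnesses\<close>). Three kinds of pairs suffice.

  If every element of the group is \<open>a + b\<close> in exactly one way, everything is a witness
  (\<open>co_minimal_pair_unique_sums\<close>). On \<open>\<int>\<^sup>2\<close> an antidiagonal \<open>\<sigma>\<close> maps the first axis to the
  second one, so the axis and its image form such a pair. On \<open>\<int>\<^sup>2\<^sup>d = \<int>\<^sup>d \<times> \<int>\<^sup>d\<close> the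
  automorphism \<open>(u, w) \<mapsto> (k u + w, u)\<close> maps the first factor to the complement
  \<open>{(k u, u)}\<close> of it, for every integer \<open>k\<close>; this gives infinitely many automorphisms.

  A diagonal \<open>\<sigma>\<close> with an entry \<open>-1\<close>, say the second one, is served by the punctured first axis
  together with the positive half of the second axis. Its image is the punctured first axis
  together with the negative half of the second one. A vector \<open>(x, y)\<close> off the axes is then a
  sum in one way only, the sign of \<open>y\<close> deciding which summand is the horizontal one
  (\<open>co_minimal_pair_half_cross\<close>).

  For the identity, \<open>a + b = b + a\<close>, so a witness for \<open>a\<close> can only be \<open>2 a\<close>. What is needed
  is a set \<open>A\<close> with \<open>A + A\<close> the whole group in which no element is the midpoint of two others.
  In \<open>\<int>\<close> the numbers with digits \<open>0\<close> and \<open>1\<close> in base \<open>-3\<close> have both properties: every integer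
  has a unique expansion in base \<open>-3\<close> with digits \<open>0, 1, 2\<close>, sums of two elements of the set
  are computed without carries, and a digit \<open>0\<close> or \<open>2\<close> is a sum of two digits in \<open>{0, 1}\<close> in
  one way only. The square of this set does the same in \<open>\<int>\<^sup>2\<close>.
\<close>

section \<open>Criteria for co-minimality\<close>

lemma co_minimal_pair_by_witnesses:
  fixes G (structure)
  assumes "monoid G" and A: "A \<subseteq> carrier G" and B: "B \<subseteq> carrier G"
    and cover: "\<And>g. g \<in> carrier G \<Longrightarrow> \<exists>a\<in>A. \<exists>b\<in>B. g = a \<otimes> b"
    and left: "\<And>a. a \<in> A \<Longrightarrow> \<exists>g\<in>carrier G. \<forall>a'\<in>A. \<forall>b\<in>B. a' \<otimes> b = g \<longrightarrow> a' = a"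
    and right: "\<And>b. b \<in> B \<Longrightarrow> \<exists>g\<in>carrier G. \<forall>a\<in>A. \<forall>b'\<in>B. a \<otimes> b' = g \<longrightarrow> b' = b"
  shows "co_minimal_pair G A B"
proof -
  interpret monoid G by fact
  have closed: "S <#> T \<subseteq> carrier G" if "S \<subseteq> A" "T \<subseteq> B" for S T
    using that A B m_closed unfolding set_mult_def by blast
  have "A <#> B = carrier G"
    using closed[of A B] cover by (fastforce simp: set_mult_def)
  moreover have "A \<noteq> {}" "B \<noteq> {}"
    using cover[OF one_closed] by auto
  moreover have "A' <#> B \<subset> carrier G" if sub: "A' \<subset> A" for A'
  proof -
    obtain a where "a \<in> A" "a \<notin> A'" using sub by blast
    with left obtain g where "g \<in> carrier G" "\<forall>a'\<in>A. \<forall>b\<in>B. a' \<otimes> b = g \<longrightarrow> a' = a"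
      by meson
    then have "g \<in> carrier G - (A' <#> B)"
      using sub \<open>a \<notin> A'\<close> by (auto simp: set_mult_def)
    then show ?thesis using closed[of A' B] sub by auto
  qed
  moreover have "A <#> B' \<subset> carrier G" if sub: "B' \<subset> B" for B'
  proof -
    obtain b where "b \<in> B" "b \<notin> B'" using sub by blast
    with right obtain g where "g \<in> carrier G" "\<forall>a\<in>A. \<forall>b'\<in>B. a \<otimes> b' = g \<longrightarrow> b' = b"
      by meson
    then have "g \<in> carrier G - (A <#> B')"
      using sub \<open>b \<notin> B'\<close> by (auto simp: set_mult_def)
    then show ?thesis using closed[of A B'] sub by auto
  qed
  ultimately show ?thesis
    using A B by (auto simp: co_minimal_pair_def)
qed

lemma co_minimal_pair_unique_sums:
  fixes G (structure)
  assumes "monoid G" and A: "A \<subseteq> carrier G" and B: "B \<subseteq> carrier G"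
    and cover: "\<And>g. g \<in> carrier G \<Longrightarrow> \<exists>a\<in>A. \<exists>b\<in>B. g = a \<otimes> b"
    and unique: "\<And>a a' b b'. \<lbrakk>a \<in> A; a' \<in> A; b \<in> B; b' \<in> B; a \<otimes> b = a' \<otimes> b'\<rbrakk>
      \<Longrightarrow> a = a' \<and> b = b'"
  shows "co_minimal_pair G A B"
proof -
  interpret monoid G by fact
  obtain a0 b0 where ab: "a0 \<in> A" "b0 \<in> B" using cover[OF one_closed] by blast
  show ?thesis
  proof (rule co_minimal_pair_by_witnesses[OF \<open>monoid G\<close> A B cover])
    show "\<exists>g\<in>carrier G. \<forall>a'\<in>A. \<forall>b\<in>B. a' \<otimes> b = g \<longrightarrow> a' = a" if "a \<in> A" for a
      by (rule bexI[of _ "a \<otimes> b0"]) (use that ab A B unique in blast)+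
    show "\<exists>g\<in>carrier G. \<forall>a\<in>A. \<forall>b'\<in>B. a \<otimes> b' = g \<longrightarrow> b' = b" if "b \<in> B" for b
      by (rule bexI[of _ "a0 \<otimes> b"]) (use that ab A B unique in blast)+
  qed
qed

lemma co_minimal_pair_midpoint_free:
  fixes G (structure)
  assumes "monoid G" and A: "A \<subseteq> carrier G"
    and cover: "\<And>g. g \<in> carrier G \<Longrightarrow> \<exists>a\<in>A. \<exists>b\<in>A. g = a \<otimes> b"
    and free: "\<And>a b c. \<lbrakk>a \<in> A; b \<in> A; c \<in> A; b \<otimes> c = a \<otimes> a\<rbrakk> \<Longrightarrow> b = a \<and> c = a"
  shows "co_minimal_pair G A A"
proof -
  interpret monoid G by fact
  show ?thesis
  proof (rule co_minimal_pair_by_witnesses[OF \<open>monoid G\<close> A A cover])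
    show "\<exists>g\<in>carrier G. \<forall>a'\<in>A. \<forall>b\<in>A. a' \<otimes> b = g \<longrightarrow> a' = a" if "a \<in> A" for a
      by (rule bexI[of _ "a \<otimes> a"]) (use that A free in blast)+
    show "\<exists>g\<in>carrier G. \<forall>a\<in>A. \<forall>b'\<in>A. a \<otimes> b' = g \<longrightarrow> b' = b" if "b \<in> A" for b
      by (rule bexI[of _ "b \<otimes> b"]) (use that A free in blast)+
  qed
qed

section \<open>Integers with digits 0 and 1 in base -3\<close>

inductive_set negaternary01 :: "int set" where
  zero: "0 \<in> negaternary01"
| digit0: "c \<in> negaternary01 \<Longrightarrow> - 3 * c \<in> negaternary01"
| digit1: "c \<in> negaternary01 \<Longrightarrow> 1 - 3 * c \<in> negaternary01"

text \<open>Since \<open>0 = 0 - 3 * 0\<close>, the number \<open>0\<close> also ends in a digit, and a case analysis on the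
  last digit needs no third case for it.\<close>

lemma negaternary01_last_digit:
  assumes "c \<in> negaternary01"
  obtains r c' where "r = 0 \<or> r = 1" "c' \<in> negaternary01" "c = r - 3 * c'"
  using assms
proof cases
  case zero
  then show ?thesis using that[of 0 0] negaternary01.zero by simp
next
  case (digit0 c')
  then show ?thesis using that[of 0 c'] by simp
next
  case (digit1 c')
  then show ?thesis using that[of 1 c'] by simp
qed

lemma negaternary01_snoc:
  "\<lbrakk>r = 0 \<or> r = 1; c \<in> negaternary01\<rbrakk> \<Longrightarrow> r - 3 * c \<in> negaternary01"
  using negaternary01.digit0[of c] negaternary01.digit1[of c] by (elim disjE) simp_all

text \<open>Expand \<open>n = r - 3 m\<close> with \<open>r \<in> {0, 1, 2}\<close>, write \<open>r\<close> as a sum of two digits in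
  \<open>{0, 1}\<close> and continue with \<open>m\<close>. The absolute value decreases unless \<open>n\<close> is \<open>0\<close> or \<open>-1\<close>.\<close>

lemma negaternary01_sums_cover:
  fixes n :: int
  shows "\<exists>b\<in>negaternary01. \<exists>c\<in>negaternary01. n = b + c"
proof (induction "nat \<bar>n\<bar>" arbitrary: n rule: less_induct)
  case less
  have one: "1 \<in> negaternary01"
    using negaternary01.digit1[OF negaternary01.zero] by simp
  consider "n = 0" | "n = -1" | "n \<noteq> 0" "n \<noteq> -1" by blast
  then show ?case
  proof cases
    case 1
    then show ?thesis using negaternary01.zero by force
  next
    case 2
    have "n = -2 + 1" using 2 by simp
    moreover have "-2 \<in> negaternary01" using negaternary01.digit1[OF one] by simp
    ultimately show ?thesis using one by blast
  next
    case 3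
    define r where "r = n mod 3"
    define m where "m = - (n div 3)"
    have n: "n = r - 3 * m" by (simp add: r_def m_def)
    have r: "r = 0 \<or> r = 1 \<or> r = 2" unfolding r_def by presburger
    have "nat \<bar>m\<bar> < nat \<bar>n\<bar>" using 3 n r by linarith
    from less[OF this] obtain b c
      where bc: "b \<in> negaternary01" "c \<in> negaternary01" "m = b + c" by blast
    obtain s t where st: "s = 0 \<or> s = (1::int)" "t = 0 \<or> t = (1::int)" "r = s + t"
    proof (cases "r = 2")
      case True
      then show ?thesis using that[of 1 1] by simp
    next
      case False
      then show ?thesis using that[of r 0] r by auto
    qed
    have "n = (s - 3 * b) + (t - 3 * c)" using n bc st by simp
    then show ?thesis
      using negaternary01_snoc[OF st(1) bc(1)] negaternary01_snoc[OF st(2) bc(2)] by blast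
  qed
qed

lemma negaternary01_opposite_eq_0:
  assumes "b \<in> negaternary01" "c \<in> negaternary01" "b + c = 0"
  shows "b = 0"
  using assms
proof (induction arbitrary: c rule: negaternary01.induct)
  case zero
  show ?case by simp
next
  case (digit0 b)
  obtain t c' where c: "t = 0 \<or> t = 1" "c' \<in> negaternary01" "c = t - 3 * c'"
    using negaternary01_last_digit[OF digit0.prems(1)] .
  have "b + c' = 0" using c(1,3) digit0.prems(2) by presburger
  then show ?case using digit0.IH[OF c(2)] by simp
next
  case (digit1 b)
  obtain t c' where "t = 0 \<or> t = 1" "c = t - 3 * c'"
    using negaternary01_last_digit[OF digit1.prems(1)] .
  with digit1.prems(2) show ?case by presburger
qed

text \<open>Modulo 3 the last digits satisfy \<open>s + t = 2 r\<close> with both sides in \<open>{0, 1, 2}\<close>, hence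
  exactly; so \<open>s = t = r\<close>, and the remaining digits satisfy the same equation. As \<open>a = 0\<close> ends
  the induction while \<open>b\<close> and \<open>c\<close> may still have digits, that case is
  \<open>negaternary01_opposite_eq_0\<close>.\<close>

lemma negaternary01_midpoint_free:
  assumes "a \<in> negaternary01" "b \<in> negaternary01" "c \<in> negaternary01" "b + c = a + a"
  shows "b = a \<and> c = a"
  using assms
proof (induction arbitrary: b c rule: negaternary01.induct)
  case zero
  then show ?case using negaternary01_opposite_eq_0[of b c] by simp
next
  case (digit0 a)
  obtain s b' where b: "s = 0 \<or> s = 1" "b' \<in> negaternary01" "b = s - 3 * b'"
    using negaternary01_last_digit[OF digit0.prems(1)] .
  obtain t c' where c: "t = 0 \<or> t = 1" "c' \<in> negaternary01" "c = t - 3 * c'"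
    using negaternary01_last_digit[OF digit0.prems(2)] .
  have "s = 0 \<and> t = 0 \<and> b' + c' = a + a"
    using b(1,3) c(1,3) digit0.prems(3) by presburger
  then show ?case using digit0.IH[OF b(2) c(2)] b(3) c(3) by simp
next
  case (digit1 a)
  obtain s b' where b: "s = 0 \<or> s = 1" "b' \<in> negaternary01" "b = s - 3 * b'"
    using negaternary01_last_digit[OF digit1.prems(1)] .
  obtain t c' where c: "t = 0 \<or> t = 1" "c' \<in> negaternary01" "c = t - 3 * c'"
    using negaternary01_last_digit[OF digit1.prems(2)] .
  have "s = 1 \<and> t = 1 \<and> b' + c' = a + a"
    using b(1,3) c(1,3) digit1.prems(3) by presburger
  then show ?case using digit1.IH[OF b(2) c(2)] b(3) c(3) by simp
qed

section \<open>Co-minimal pairs in the planar lattice\<close>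

lemma monoid_int_lattice: "monoid (int_lattice n)"
proof -
  interpret comm_group "int_lattice n" by (rule comm_group_vec)
  show ?thesis by (rule monoid_axioms)
qed

lemma image_eq_of_bij_betw:
  assumes "bij_betw f S T" "A \<subseteq> S" "B \<subseteq> T" "\<And>x. x \<in> S \<Longrightarrow> f x \<in> B \<longleftrightarrow> x \<in> A"
  shows "f ` A = B"
proof
  show "f ` A \<subseteq> B" using assms(2,4) by blast
  show "B \<subseteq> f ` A"
  proof
    fix y assume "y \<in> B"
    then obtain x where "x \<in> S" "y = f x"
      using assms(1,3) by (auto simp: bij_betw_def)
    then show "y \<in> f ` A" using assms(4) \<open>y \<in> B\<close> by auto
  qed
qed

text \<open>Speaking of coordinates \<open>i\<close> and \<open>j\<close> with \<open>{i, j} = {0, 1}\<close>, instead of the first and the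
  second one, makes the arguments below apply to either order of the axes.\<close>

lemma vec2_eqI:
  assumes "{i, j} = {0, 1 :: nat}" "v \<in> carrier_vec 2" "w \<in> carrier_vec 2"
    "v $ i = w $ i" "v $ j = w $ j"
  shows "v = w"
proof (rule eq_vecI)
  fix k assume "k < dim_vec w"
  then have "k \<in> {0, 1}" using assms(3) by auto
  then have "k \<in> {i, j}" by (simp only: assms(1))
  then show "v $ k = w $ k" using assms(4,5) by auto
qed (use assms(2,3) in auto)

lemma vec2_with_coords:
  assumes "{i, j} = {0, 1 :: nat}"
  obtains v where "v \<in> carrier_vec 2" "v $ i = x" "v $ j = y"
proof -
  have "i \<noteq> j" "i < 2" "j < 2" using assms by (auto simp: doubleton_eq_iff)
  then show ?thesis using that[of "vec 2 (\<lambda>k. if k = i then x else y)"] by auto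
qed

lemma co_minimal_pair_negaternary01_square:
  "co_minimal_pair (int_lattice 2) {v \<in> carrier_vec 2. v $ 0 \<in> negaternary01 \<and> v $ 1 \<in> negaternary01}
     {v \<in> carrier_vec 2. v $ 0 \<in> negaternary01 \<and> v $ 1 \<in> negaternary01}"
    (is "co_minimal_pair _ ?A _")
proof (rule co_minimal_pair_midpoint_free[OF monoid_int_lattice], unfold monoid_vec_simps)
  show "?A \<subseteq> carrier_vec 2" by blast
  show "\<exists>a\<in>?A. \<exists>b\<in>?A. g = a + b" if g: "g \<in> carrier_vec 2" for g
  proof -
    obtain x x' where x: "x \<in> negaternary01" "x' \<in> negaternary01" "g $ 0 = x + x'"
      using negaternary01_sums_cover by blast
    obtain y y' where y: "y \<in> negaternary01" "y' \<in> negaternary01" "g $ 1 = y + y'"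
      using negaternary01_sums_cover by blast
    obtain a where a: "a \<in> carrier_vec 2" "a $ 0 = x" "a $ 1 = y"
      using vec2_with_coords[OF refl] .
    obtain b where b: "b \<in> carrier_vec 2" "b $ 0 = x'" "b $ 1 = y'"
      using vec2_with_coords[OF refl] .
    have "g = a + b" using g a b x y by (intro vec2_eqI[of 0 1]) auto
    then show ?thesis using a b x y by auto
  qed
  show "b = a \<and> c = a" if "a \<in> ?A" "b \<in> ?A" "c \<in> ?A" "b + c = a + a" for a b c
  proof -
    have "b $ k + c $ k = a $ k + a $ k" if "k < 2" for k
      using arg_cong[OF \<open>b + c = a + a\<close>, of "\<lambda>v. v $ k"] that \<open>a \<in> ?A\<close> \<open>c \<in> ?A\<close> by auto
    from this[of 0] this[of 1]
    have "b $ 0 = a $ 0 \<and> c $ 0 = a $ 0" "b $ 1 = a $ 1 \<and> c $ 1 = a $ 1"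
      using that by (intro negaternary01_midpoint_free; simp)+
    then show ?thesis using that by (intro conjI vec2_eqI[of 0 1]) auto
  qed
qed

text \<open>Sums within one axis fill that axis, and a sum that lies off the axes takes one summand
  from each. A positive \<open>j\<close>-coordinate then forces the \<open>j\<close>-axis summand to come from the left
  set and a negative one forces it to come from the right set, so each vector off the axes is
  a witness for both of its summands.\<close>

lemma co_minimal_pair_half_cross:
  assumes ij: "{i, j} = {0, 1 :: nat}"
  shows "co_minimal_pair (int_lattice 2)
     {v \<in> carrier_vec 2. v $ i \<noteq> 0 \<and> v $ j = 0 \<or> v $ i = 0 \<and> v $ j > 0}
     {v \<in> carrier_vec 2. v $ i \<noteq> 0 \<and> v $ j = 0 \<or> v $ i = 0 \<and> v $ j < 0}"
    (is "co_minimal_pair _ ?A ?B")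
proof (rule co_minimal_pair_by_witnesses[OF monoid_int_lattice], unfold monoid_vec_simps)
  have lt: "i < 2" "j < 2" using ij by (auto simp: doubleton_eq_iff)
  have coords: "(a + b) $ i = a $ i + b $ i" "(a + b) $ j = a $ j + b $ j"
    if "b \<in> carrier_vec 2" for a b :: "int vec"
    using that lt by auto
  show "?A \<subseteq> carrier_vec 2" "?B \<subseteq> carrier_vec 2" by blast+
  show "\<exists>a\<in>?A. \<exists>b\<in>?B. g = a + b" if g: "g \<in> carrier_vec 2" for g
  proof -
    have "\<exists>x y x' y'. g $ i = x + x' \<and> g $ j = y + y' \<and>
        (x \<noteq> 0 \<and> y = 0 \<or> x = 0 \<and> y > 0) \<and> (x' \<noteq> 0 \<and> y' = 0 \<or> x' = 0 \<and> y' < 0)"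
    proof -
      consider "g $ j = 0" | "g $ i = 0" | "g $ i \<noteq> 0" "g $ j > 0" | "g $ i \<noteq> 0" "g $ j < 0"
        by linarith
      then show ?thesis
      proof cases
        case 1
        \<comment> \<open>Any \<open>x\<close> other than \<open>0\<close> and \<open>g $ i\<close> will do.\<close>
        define x :: int where "x = (if g $ i = 1 then 2 else 1)"
        show ?thesis
          by (intro exI[of _ x] exI[of _ 0] exI[of _ "g $ i - x"]) (use 1 in \<open>auto simp: x_def\<close>)
      next
        case 2
        \<comment> \<open>The two summands must have opposite signs, whatever the sign of \<open>g $ j\<close>.\<close>
        show ?thesis
          by (intro exI[of _ 0] exI[of _ "\<bar>g $ j\<bar> + 1"] exI[of _ "g $ j - \<bar>g $ j\<bar> - 1"])
            (use 2 in auto)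
      next
        case 3
        show ?thesis
          by (intro exI[of _ 0] exI[of _ "g $ j"] exI[of _ "g $ i"]) (use 3 in auto)
      next
        case 4
        show ?thesis
          by (intro exI[of _ "g $ i"] exI[of _ 0] exI[of _ "g $ j"]) (use 4 in auto)
      qed
    qed
    then obtain x y x' y' where xy: "g $ i = x + x'" "g $ j = y + y'"
      "x \<noteq> 0 \<and> y = 0 \<or> x = 0 \<and> y > 0" "x' \<noteq> 0 \<and> y' = 0 \<or> x' = 0 \<and> y' < 0" by blast
    obtain a where a: "a \<in> carrier_vec 2" "a $ i = x" "a $ j = y"
      using vec2_with_coords[OF ij] .
    obtain b where b: "b \<in> carrier_vec 2" "b $ i = x'" "b $ j = y'"
      using vec2_with_coords[OF ij] .
    have "g = a + b"
      using g a b xy by (intro vec2_eqI[OF ij]) (auto simp: coords)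
    moreover have "a \<in> ?A" "b \<in> ?B" using a b xy by auto
    ultimately show ?thesis by blast
  qed
  show "\<exists>g\<in>carrier_vec 2. \<forall>a'\<in>?A. \<forall>b\<in>?B. a' + b = g \<longrightarrow> a' = a" if a: "a \<in> ?A" for a
  proof -
    \<comment> \<open>The sum of \<open>a\<close> and a unit vector of the other axis, negative if that is the \<open>j\<close>-axis.\<close>
    obtain g :: "int vec" where g: "g \<in> carrier_vec 2"
      "g $ i = (if a $ j = 0 then a $ i else 1)" "g $ j = (if a $ j = 0 then -1 else a $ j)"
      using vec2_with_coords[OF ij] .
    have "a' = a" if "a' \<in> ?A" "b \<in> ?B" "a' + b = g" for a' b
    proof (rule vec2_eqI[OF ij])
      have "g $ i = a' $ i + b $ i" "g $ j = a' $ j + b $ j"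
        using that coords[of b a'] by auto
      then show "a' $ i = a $ i" "a' $ j = a $ j"
        using that(1,2) a g by (auto split: if_splits)
    qed (use that a in auto)
    then show ?thesis using g(1) by blast
  qed
  show "\<exists>g\<in>carrier_vec 2. \<forall>a\<in>?A. \<forall>b'\<in>?B. a + b' = g \<longrightarrow> b' = b" if b: "b \<in> ?B" for b
  proof -
    \<comment> \<open>Here the summand on the other axis is the left one, so it is a positive unit vector.\<close>
    obtain g :: "int vec" where g: "g \<in> carrier_vec 2"
      "g $ i = (if b $ j = 0 then b $ i else 1)" "g $ j = (if b $ j = 0 then 1 else b $ j)"
      using vec2_with_coords[OF ij] .
    have "b' = b" if "a \<in> ?A" "b' \<in> ?B" "a + b' = g" for a b'
    proof (rule vec2_eqI[OF ij])
      have "g $ i = a $ i + b' $ i" "g $ j = a $ j + b' $ j"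
        using that coords[of b' a] by auto
      then show "b' $ i = b $ i" "b' $ j = b $ j"
        using that(1,2) b g by (auto split: if_splits)
    qed (use that b in auto)
    then show ?thesis using g(1) by blast
  qed
qed

lemma co_minimal_pair_axes:
  "co_minimal_pair (int_lattice 2) {v \<in> carrier_vec 2. v $ 1 = 0} {v \<in> carrier_vec 2. v $ 0 = 0}"
    (is "co_minimal_pair _ ?A ?B")
proof (rule co_minimal_pair_unique_sums[OF monoid_int_lattice], unfold monoid_vec_simps)
  show "?A \<subseteq> carrier_vec 2" "?B \<subseteq> carrier_vec 2" by blast+
  show "\<exists>a\<in>?A. \<exists>b\<in>?B. g = a + b" if g: "g \<in> carrier_vec 2" for g
  proof -
    obtain a where a: "a \<in> carrier_vec 2" "a $ 0 = g $ 0" "a $ 1 = 0"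
      using vec2_with_coords[OF refl] .
    obtain b where b: "b \<in> carrier_vec 2" "b $ 0 = 0" "b $ 1 = g $ 1"
      using vec2_with_coords[OF refl] .
    have "g = a + b" using g a b by (intro vec2_eqI[of 0 1]) auto
    then show ?thesis using a b by blast
  qed
  show "a = a' \<and> b = b'"
    if "a \<in> ?A" "a' \<in> ?A" "b \<in> ?B" "b' \<in> ?B" "a + b = a' + b'" for a a' b b'
  proof -
    have "a $ k + b $ k = a' $ k + b' $ k" if "k < 2" for k
      using arg_cong[OF \<open>a + b = a' + b'\<close>, of "\<lambda>v. v $ k"] that \<open>b \<in> ?B\<close> \<open>b' \<in> ?B\<close> by auto
    from this[of 0] this[of 1] have "a $ 0 = a' $ 0" "b $ 1 = b' $ 1"
      using that by auto
    then show ?thesis using that by (intro conjI vec2_eqI[of 0 1]) auto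
  qed
qed

section \<open>Automorphisms of the planar lattice with two nonzero entries\<close>

text \<open>Surjectivity gives an integer right inverse of the matrix. So no row vanishes, the two
  nonzero entries lie in different rows, and they cannot share a column; each of them then
  divides \<open>1\<close>.\<close>

lemma auto_two_nonzero_entries:
  assumes \<sigma>: "\<sigma> \<in> auto (int_lattice 2)"
    and two: "card (nonzero_entries (matrix_of 2 \<sigma>)) = 2"
  obtains (diagonal) p s where "\<bar>p\<bar> = 1" "\<bar>s\<bar> = 1"
      "\<And>v. v \<in> carrier_vec 2 \<Longrightarrow> \<sigma> v $ 0 = p * v $ 0 \<and> \<sigma> v $ 1 = s * v $ 1"
    | (antidiagonal) q r where "\<bar>q\<bar> = 1" "\<bar>r\<bar> = 1"
      "\<And>v. v \<in> carrier_vec 2 \<Longrightarrow> \<sigma> v $ 0 = q * v $ 1 \<and> \<sigma> v $ 1 = r * v $ 0"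
proof -
  let ?M = "matrix_of 2 \<sigma>"
  have hom: "\<sigma> \<in> hom (int_lattice 2) (int_lattice 2)"
    and bij: "bij_betw \<sigma> (carrier_vec 2) (carrier_vec 2)"
    using \<sigma> by (auto simp: auto_def Bij_def monoid_vec_simps)
  define p q r s where "p = ?M $$ (0, 0)" and "q = ?M $$ (0, 1)"
    and "r = ?M $$ (1, 0)" and "s = ?M $$ (1, 1)"
  have M: "?M \<in> carrier_mat 2 2" by (simp add: matrix_of_def)
  have \<sigma>v: "\<sigma> v $ 0 = p * v $ 0 + q * v $ 1 \<and> \<sigma> v $ 1 = r * v $ 0 + s * v $ 1"
    if "v \<in> carrier_vec 2" for v
  proof -
    have "\<sigma> v $ k = ?M $$ (k, 0) * v $ 0 + ?M $$ (k, 1) * v $ 1" if "k < 2" for k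
    proof -
      have "{0..<2} = {0, 1 :: nat}" by auto
      then have "row ?M k \<bullet> v = ?M $$ (k, 0) * v $ 0 + ?M $$ (k, 1) * v $ 1"
        using \<open>v \<in> carrier_vec 2\<close> that M by (simp add: scalar_prod_def)
      moreover have "\<sigma> v $ k = row ?M k \<bullet> v"
        unfolding matrix_of_mult_vec[OF hom \<open>v \<in> carrier_vec 2\<close>, symmetric]
        using that M by (intro index_mult_mat_vec) simp
      ultimately show ?thesis by (simp only:)
    qed
    from this[of 0] this[of 1] show ?thesis by (simp add: p_def q_def r_def s_def)
  qed
  have onto: "\<exists>x y. p * x + q * y = m \<and> r * x + s * y = n" for m n
  proof -
    obtain w :: "int vec" where w: "w \<in> carrier_vec 2" "w $ 0 = m" "w $ 1 = n"
      using vec2_with_coords[OF refl] .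
    obtain v where "v \<in> carrier_vec 2" "\<sigma> v = w"
      using bij w(1) by (metis bij_betw_def imageE)
    then show ?thesis using \<sigma>v[of v] w by auto
  qed
  obtain x y where xy: "p * x + q * y = 1" "r * x + s * y = 0" using onto by blast
  obtain z w where zw: "p * z + q * w = 0" "r * z + s * w = 1" using onto by blast
  have "dim_row ?M = 2" "dim_col ?M = 2" using M by auto
  then have "nonzero_entries ?M = {(0, 0), (0, 1), (1, 0), (1, 1)} \<inter> {ij. ?M $$ ij \<noteq> 0}"
    unfolding nonzero_entries_def less_2_cases_iff by auto
  with two have "(\<Sum>ij\<in>{(0, 0), (0, 1), (1, 0), (1, 1)}. of_bool (?M $$ ij \<noteq> 0)) = (2 :: nat)"
    by (subst sum_of_bool_eq) simp_all
  then have "of_bool (p \<noteq> 0) + of_bool (q \<noteq> 0) + of_bool (r \<noteq> 0) + of_bool (s \<noteq> 0) = (2 :: nat)"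
    by (simp add: p_def q_def r_def s_def del: sum_of_bool_eq)
  moreover have "p \<noteq> 0 \<or> q \<noteq> 0" "r \<noteq> 0 \<or> s \<noteq> 0" using xy zw by auto
  moreover have "p \<noteq> 0 \<or> r \<noteq> 0" "q \<noteq> 0 \<or> s \<noteq> 0" using xy zw by auto
  ultimately consider "q = 0" "r = 0" | "p = 0" "s = 0"
    by (cases "p = 0"; cases "q = 0"; cases "r = 0"; cases "s = 0") simp_all
  then show ?thesis
  proof cases
    case 1
    with xy(1) zw(2) have "p * x = 1" "s * w = 1" by simp_all
    then have "\<bar>p\<bar> = 1" "\<bar>s\<bar> = 1" by (metis dvd_triv_left zdvd1_eq)+
    then show ?thesis using diagonal \<sigma>v 1 by simp
  next
    case 2
    with xy(1) zw(2) have "q * y = 1" "r * z = 1" by simp_all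
    then have "\<bar>q\<bar> = 1" "\<bar>r\<bar> = 1" by (metis dvd_triv_left zdvd1_eq)+
    then show ?thesis using antidiagonal \<sigma>v 2 by simp
  qed
qed

lemma co_minimal_pair_two_nonzero_entries:
  assumes \<sigma>: "\<sigma> \<in> auto (int_lattice 2)"
    and two: "card (nonzero_entries (matrix_of 2 \<sigma>)) = 2"
  shows "\<exists>A. A \<subseteq> carrier (int_lattice 2) \<and> co_minimal_pair (int_lattice 2) A (\<sigma> ` A)"
proof -
  have bij: "bij_betw \<sigma> (carrier_vec 2) (carrier_vec 2)"
    using \<sigma> by (auto simp: auto_def Bij_def monoid_vec_simps)
  have witness: ?thesis
    if "co_minimal_pair (int_lattice 2) A B" "\<And>v. v \<in> carrier_vec 2 \<Longrightarrow> \<sigma> v \<in> B \<longleftrightarrow> v \<in> A" for A B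
  proof -
    have "A \<subseteq> carrier_vec 2" "B \<subseteq> carrier_vec 2"
      using that(1) by (auto simp: co_minimal_pair_def monoid_vec_simps)
    with that bij have "\<sigma> ` A = B" by (intro image_eq_of_bij_betw)
    with that(1) show ?thesis by (auto simp: co_minimal_pair_def)
  qed
  have closed: "\<sigma> v \<in> carrier_vec 2" if "v \<in> carrier_vec 2" for v
    using bij that by (rule bij_betw_apply)
  from \<sigma> two show ?thesis
  proof (cases rule: auto_two_nonzero_entries)
    case (diagonal p s)
    have signs: "p = 1 \<or> p = -1" "s = 1 \<or> s = -1" using diagonal(1,2) by linarith+
    consider "p = 1" "s = 1" | "s = -1" | "p = -1" using signs by blast
    then show ?thesis
    proof cases
      case 1
      show ?thesis
        by (rule witness[OF co_minimal_pair_negaternary01_square])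
          (use 1 diagonal(3) closed in auto)
    next
      case 2
      show ?thesis
        by (rule witness[OF co_minimal_pair_half_cross[of 0 1]])
          (use 2 signs diagonal(3) closed in auto)
    next
      case 3
      show ?thesis
        by (rule witness[OF co_minimal_pair_half_cross[of 1 0]])
          (use 3 signs diagonal(3) closed in auto)
    qed
  next
    case (antidiagonal q r)
    show ?thesis
      by (rule witness[OF co_minimal_pair_axes]) (use antidiagonal closed in auto)
  qed
qed

section \<open>Infinitely many automorphisms in even rank\<close>

text \<open>The block matrix with rows \<open>(k I, I)\<close> and \<open>(I, 0)\<close>, all blocks being \<open>d \<times> d\<close>,
  made extensional as membership in \<open>auto\<close> requires.\<close>

definition block_auto :: "nat \<Rightarrow> int \<Rightarrow> int vec \<Rightarrow> int vec" where
  "block_auto d k = restrict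
     (\<lambda>v. vec (2 * d) (\<lambda>i. if i < d then k * v $ i + v $ (i + d) else v $ (i - d)))
     (carrier_vec (2 * d))"

lemma block_auto_closed: "v \<in> carrier_vec (2 * d) \<Longrightarrow> block_auto d k v \<in> carrier_vec (2 * d)"
  by (simp add: block_auto_def)

lemma block_auto_index:
  assumes "v \<in> carrier_vec (2 * d)" "i < d"
  shows "block_auto d k v $ i = k * v $ i + v $ (i + d)" "block_auto d k v $ (i + d) = v $ i"
  using assms by (simp_all add: block_auto_def)

lemma half_vec_eqI:
  assumes "v \<in> carrier_vec (2 * d)" "w \<in> carrier_vec (2 * d)"
    "\<And>i. i < d \<Longrightarrow> v $ i = w $ i" "\<And>i. i < d \<Longrightarrow> v $ (i + d) = w $ (i + d)"
  shows "v = w"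
proof (rule eq_vecI)
  fix i assume "i < dim_vec w"
  then show "v $ i = w $ i"
    using assms(2,3) assms(4)[of "i - d"] by (cases "i < d") auto
qed (use assms in auto)

lemma block_auto_in_auto: "block_auto d k \<in> auto (int_lattice (2 * d))"
proof -
  define inverse :: "int vec \<Rightarrow> int vec" where
    "inverse w = vec (2 * d) (\<lambda>i. if i < d then w $ (i + d) else w $ (i - d) - k * w $ i)" for w
  have inv_closed: "inverse w \<in> carrier_vec (2 * d)" for w by (simp add: inverse_def)
  have inv_index: "inverse w $ i = w $ (i + d)" "inverse w $ (i + d) = w $ i - k * w $ (i + d)"
    if "i < d" for w i
    using that by (simp_all add: inverse_def)
  have "bij_betw (block_auto d k) (carrier_vec (2 * d)) (carrier_vec (2 * d))"
    by (rule bij_betw_byWitness[where f' = inverse])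
      (auto intro!: half_vec_eqI[of _ d] block_auto_closed inv_closed
         simp: block_auto_index inv_index block_auto_closed inv_closed)
  moreover have "block_auto d k (v + w) = block_auto d k v + block_auto d k w"
    if "v \<in> carrier_vec (2 * d)" "w \<in> carrier_vec (2 * d)" for v w
  proof (rule half_vec_eqI)
    show "block_auto d k (v + w) \<in> carrier_vec (2 * d)"
      using that by (intro block_auto_closed add_carrier_vec)
    show "block_auto d k v + block_auto d k w \<in> carrier_vec (2 * d)"
      using that by (intro block_auto_closed add_carrier_vec)
  qed (use that block_auto_closed[OF that(2), of k] in \<open>simp_all add: block_auto_index algebra_simps\<close>)
  ultimately show ?thesis
    by (auto simp: auto_def Bij_def hom_def monoid_vec_simps block_auto_closed)
      (simp add: block_auto_def)
qed

text \<open>In \<open>a + block_auto d k c\<close>, with \<open>a\<close> and \<open>c\<close> supported on the first half, the second half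
  of the sum is \<open>c\<close>, and the first half then determines \<open>a\<close>.\<close>

lemma co_minimal_pair_block_auto:
  defines "A \<equiv> \<lambda>d. {v \<in> carrier_vec (2 * d). \<forall>i<d. v $ (i + d) = (0 :: int)}"
  shows "co_minimal_pair (int_lattice (2 * d)) (A d) (block_auto d k ` A d)"
proof (rule co_minimal_pair_unique_sums[OF monoid_int_lattice], unfold monoid_vec_simps)
  show "A d \<subseteq> carrier_vec (2 * d)" by (auto simp: A_def)
  show "block_auto d k ` A d \<subseteq> carrier_vec (2 * d)"
    by (auto simp: A_def intro!: block_auto_closed)
  have sum_index: "(a + block_auto d k c) $ i = a $ i + k * c $ i"
      "(a + block_auto d k c) $ (i + d) = c $ i"
    if "a \<in> A d" "c \<in> A d" "i < d" for a c i
    using that block_auto_closed[of c d k] by (auto simp: A_def block_auto_index)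
  show "\<exists>a\<in>A d. \<exists>b\<in>block_auto d k ` A d. g = a + b" if g: "g \<in> carrier_vec (2 * d)" for g
  proof -
    define a where "a = vec (2 * d) (\<lambda>i. if i < d then g $ i - k * g $ (i + d) else 0)"
    define c where "c = vec (2 * d) (\<lambda>i. if i < d then g $ (i + d) else 0)"
    have ac: "a \<in> A d" "c \<in> A d" by (auto simp: A_def a_def c_def)
    have "g = a + block_auto d k c"
    proof (rule half_vec_eqI[OF g])
      show "a + block_auto d k c \<in> carrier_vec (2 * d)"
        using ac by (auto simp: A_def intro!: add_carrier_vec block_auto_closed)
    qed (simp_all only: sum_index[OF ac], simp_all add: a_def c_def)
    then show ?thesis using ac by blast
  qed
  show "a = a' \<and> b = b'"
    if ab: "a \<in> A d" "a' \<in> A d" "b \<in> block_auto d k ` A d" "b' \<in> block_auto d k ` A d"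
      "a + b = a' + b'" for a a' b b'
  proof -
    obtain c c' where c: "c \<in> A d" "c' \<in> A d" "b = block_auto d k c" "b' = block_auto d k c'"
      using ab by blast
    have half: "c $ i = c' $ i" "a $ i = a' $ i" if "i < d" for i
      using sum_index[OF ab(1) c(1) that] sum_index[OF ab(2) c(2) that] ab(5) c(3,4) by auto
    have "c = c'" "a = a'"
      using ab(1,2) c(1,2) half unfolding A_def by (intro half_vec_eqI[of _ d]; simp)+
    then show ?thesis using c by simp
  qed
qed

lemma inj_block_auto:
  assumes "d \<ge> 1"
  shows "inj (block_auto d)"
proof (rule injI)
  fix k l assume eq: "block_auto d k = block_auto d l"
  have "block_auto d m (unit_vec (2 * d) 0) $ 0 = m" for m
    using assms by (subst block_auto_index) auto
  then show "k = l" using eq by metis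
qed

theorem theorem1p3:
  shows "(\<forall>\<sigma> \<in> auto (int_lattice 2). card (nonzero_entries (matrix_of 2 \<sigma>)) = 2 \<longrightarrow>
            (\<exists>A. A \<subseteq> carrier (int_lattice 2) \<and> co_minimal_pair (int_lattice 2) A (\<sigma> ` A)))
       \<and> (\<forall>d::nat. d \<ge> 1 \<longrightarrow>
            infinite {\<sigma> \<in> auto (int_lattice (2 * d)).
              \<exists>A. A \<subseteq> carrier (int_lattice (2 * d)) \<and>
                  co_minimal_pair (int_lattice (2 * d)) A (\<sigma> ` A)})"
proof (intro conjI ballI allI impI)
  fix \<sigma> assume "\<sigma> \<in> auto (int_lattice 2)" "card (nonzero_entries (matrix_of 2 \<sigma>)) = 2"
  then show "\<exists>A. A \<subseteq> carrier (int_lattice 2) \<and> co_minimal_pair (int_lattice 2) A (\<sigma> ` A)"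
    by (rule co_minimal_pair_two_nonzero_entries)
next
  fix d :: nat assume d: "d \<ge> 1"
  have "\<exists>A. A \<subseteq> carrier (int_lattice (2 * d)) \<and>
      co_minimal_pair (int_lattice (2 * d)) A (block_auto d k ` A)" for k
    using co_minimal_pair_block_auto[of d k] by (auto simp: co_minimal_pair_def)
  then have "range (block_auto d) \<subseteq> {\<sigma> \<in> auto (int_lattice (2 * d)).
      \<exists>A. A \<subseteq> carrier (int_lattice (2 * d)) \<and>
          co_minimal_pair (int_lattice (2 * d)) A (\<sigma> ` A)}"
    using block_auto_in_auto by blast
  moreover have "infinite (range (block_auto d))"
    using inj_block_auto[OF d] by (simp add: finite_image_iff infinite_UNIV_int)
  ultimately show "infinite {\<sigma> \<in> auto (int_lattice (2 * d)).
      \<exists>A. A \<subseteq> carrier (int_lattice (2 * d)) \<and>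
          co_minimal_pair (int_lattice (2 * d)) A (\<sigma> ` A)}"
    by (rule infinite_super)
qed

end
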